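(* For every integer $n \ge 1$, the reverse permutation $R_n = (n, n-1, \ldots, 2, 1)$ can be transformed into the identity permutation $I_n = (1,2,\ldots,n)$ by a sequence of at most $\frac{3}{2}n^2$ LRE moves. (For $n\ge 3$, a sequence of exactly $\frac{3}{2}n^2 - \frac{19}{2}n + 18$ moves suffices.)
   Context: Permutations of $\{1,\ldots,n\}$ are written as sequences $(a_1,\ldots,a_n)$. The LRE moves are: $L$ (left rotate), $(a_1,\ldots,a_n)\mapsto(a_2,\ldots,a_n,a_1)$; $R$ (right rotate), $(a_1,\ldots,a_n)\mapsto(a_n,a_1,\ldots,a_{n-1})$; $E$ (exchange), $(a_1,a_2,a_3,\ldots,a_n)\mapsto(a_2,a_1,a_3,\ldots,a_n)$. Moves are applied one after another. *)

theory Defs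
  imports Complex_Main
begin

text \<open>Permutations of \<open>{1,\<dots>,n}\<close> are lists of naturals.\<close>

datatype lre_move = L | R | E

definition right_rotate :: "'a list \<Rightarrow> 'a list" where
  "right_rotate xs = (if xs = [] then [] else last xs # butlast xs)"

text \<open>The exchange needs two entries; on shorter lists it is taken to do nothing.\<close>

fun exchange :: "'a list \<Rightarrow> 'a list" where
  "exchange (x # y # xs) = y # x # xs"
| "exchange xs = xs"

fun apply_move :: "lre_move \<Rightarrow> 'a list \<Rightarrow> 'a list" where
  "apply_move L = rotate1"
| "apply_move R = right_rotate"
| "apply_move E = exchange"

text \<open>The head of the list of moves is applied first.\<close>

definition apply_moves :: "lre_move list \<Rightarrow> 'a list \<Rightarrow> 'a list" where
  "apply_moves ms xs = fold apply_move ms xs"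

definition identity_perm :: "nat \<Rightarrow> nat list" where
  "identity_perm n = [1..<n + 1]"

definition reverse_perm :: "nat \<Rightarrow> nat list" where
  "reverse_perm n = rev [1..<n + 1]"

end

theory Submission
  imports Defs
begin

text \<open>
  Moving the first entry past \<open>m \<ge> 1\<close> others and rotating back costs \<open>3 m - 2\<close> moves, so iterating
  this reverses a prefix of length \<open>k\<close> at a cost of \<open>(k - 1) (3 k - 4) / 2\<close>.
  Because rotations are available, it suffices to reverse two complementary arcs of the cycle:
  exchange the first two entries, rotate them to the back, and reverse the remaining
  \<open>n - 2\<close> entries.
\<close>

lemma apply_moves_Nil [simp]: "apply_moves [] xs = xs"
  by (simp add: apply_moves_def)

lemma apply_moves_Cons [simp]: "apply_moves (m # ms) xs = apply_moves ms (apply_move m xs)"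
  by (simp add: apply_moves_def)

lemma apply_moves_append [simp]:
  "apply_moves (ms @ ms') xs = apply_moves ms' (apply_moves ms xs)"
  by (simp add: apply_moves_def)

lemma right_rotate_snoc [simp]: "right_rotate (xs @ [x]) = x # xs"
  by (simp add: right_rotate_def)

text \<open>The case \<open>Suc 0\<close> stands apart because nothing is left to pass after its
  \<open>E\<close>: omitting the pair \<open>L\<close>, \<open>R\<close> there saves two
  moves.\<close>

fun carry_moves :: "nat \<Rightarrow> lre_move list" where
  "carry_moves 0 = []"
| "carry_moves (Suc 0) = [E]"
| "carry_moves (Suc (Suc m)) = E # L # carry_moves (Suc m) @ [R]"

lemma apply_carry_moves:
  "length ys = m \<Longrightarrow> apply_moves (carry_moves m) (x # ys @ zs) = ys @ x # zs"
proof (induction m arbitrary: ys zs rule: carry_moves.induct)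
  case (3 m)
  then obtain y ys' where ys: "ys = y # ys'" "length ys' = Suc m"
    by (cases ys) auto
  \<comment> \<open>After \<open>E\<close> and \<open>L\<close> the passed entry \<open>y\<close>
    waits at the far end, so the induction hypothesis is used with \<open>y\<close> appended to
    \<open>zs\<close>; the final \<open>R\<close> brings \<open>y\<close> back to the front.\<close>
  have "apply_moves (carry_moves (Suc m)) (x # ys' @ zs @ [y]) = (ys' @ x # zs) @ [y]"
    using "3.IH"[OF ys(2), of "zs @ [y]"] by simp
  then show ?case
    using ys right_rotate_snoc[of "ys' @ x # zs" y] by simp
qed (auto simp: length_Suc_conv)

lemma length_carry_moves_Suc: "length (carry_moves (Suc m)) = 3 * m + 1"
  by (induction m) auto

fun reversal_moves :: "nat \<Rightarrow> lre_move list" where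
  "reversal_moves 0 = []"
| "reversal_moves (Suc m) = carry_moves m @ reversal_moves m"

text \<open>The carried first entry lands directly behind the other \<open>m\<close>, in its final
  place, where it joins the untouched tail \<open>zs\<close> for the next round.\<close>

lemma apply_reversal_moves:
  "length xs = m \<Longrightarrow> apply_moves (reversal_moves m) (xs @ zs) = rev xs @ zs"
proof (induction m arbitrary: xs zs)
  case (Suc m)
  then obtain x xs' where "xs = x # xs'" "length xs' = m"
    by (cases xs) auto
  then show ?case
    using Suc.IH by (simp add: apply_carry_moves)
qed simp

text \<open>Summing \<open>3 * j + 1\<close> over \<open>j < m\<close> gives the count; the additive
  form avoids division and truncated subtraction.\<close>

lemma length_reversal_moves_Suc: "2 * length (reversal_moves (Suc m)) + m = 3 * m * m"
proof (induction m)
  case (Suc m)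
  then show ?case
    \<comment> \<open>Only the outermost reversal is unfolded, so that
      \<open>reversal_moves (Suc m)\<close> still matches the induction hypothesis.\<close>
    by (simp add: length_carry_moves_Suc reversal_moves.simps(2)[of "Suc m"] algebra_simps
        del: carry_moves.simps reversal_moves.simps)
qed simp

text \<open>\<open>E # L # L\<close> turns \<open>a # b # xs\<close> into
  \<open>xs @ [b, a]\<close>, whose last two entries are already in their final places.\<close>

lemma apply_full_reversal:
  "apply_moves (E # L # L # reversal_moves (length xs)) (a # b # xs) = rev (a # b # xs)"
  using apply_reversal_moves[of xs "length xs" "[b, a]"] by simp

lemma ex_moves_reverse_to_identity:
  assumes "n \<ge> 3"
  shows "\<exists>ms. real (length ms) = 3 / 2 * real n ^ 2 - 19 / 2 * real n + 18 \<and>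
              apply_moves ms (reverse_perm n) = identity_perm n"
proof -
  \<comment> \<open>The arc of \<open>n - 2\<close> entries then has length \<open>Suc m\<close>,
    the form required by the count; the total is 3 + (3 m^2 - m) / 2.\<close>
  obtain m where n: "n = m + 3"
    using assms by (metis add.commute le_Suc_ex)
  have len: "length (reverse_perm n) = Suc (Suc (Suc m))"
    by (simp add: reverse_perm_def n)
  then obtain a b xs where xs: "reverse_perm n = a # b # xs" "length xs = Suc m"
    by (metis length_Suc_conv)
  let ?ms = "E # L # L # reversal_moves (Suc m)"
  have "apply_moves ?ms (reverse_perm n) = rev (reverse_perm n)"
    using apply_full_reversal[of xs a b] xs by simp
  also have "\<dots> = identity_perm n"
    by (simp add: reverse_perm_def identity_perm_def)
  finally have "apply_moves ?ms (reverse_perm n) = identity_perm n" .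
  moreover have "2 * real (length (reversal_moves (Suc m))) + real m = 3 * real m * real m"
    using arg_cong[OF length_reversal_moves_Suc[of m], of real]
    by (simp only: of_nat_add of_nat_mult of_nat_numeral)
  then have "real (length ?ms) = 3 / 2 * real n ^ 2 - 19 / 2 * real n + 18"
    by (simp add: n power2_eq_square field_simps)
  ultimately show ?thesis
    by blast
qed

theorem theorem1:
  fixes n :: nat
  assumes "n \<ge> 1"
  shows "(\<exists>ms :: lre_move list.
            real (length ms) \<le> 3 / 2 * real n ^ 2 \<and>
            apply_moves ms (reverse_perm n) = identity_perm n) \<and>
         (n \<ge> 3 \<longrightarrow>
            (\<exists>ms :: lre_move list.
               real (length ms) = 3 / 2 * real n ^ 2 - 19 / 2 * real n + 18 \<and>
               apply_moves ms (reverse_perm n) = identity_perm n))"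
proof (cases "n \<ge> 3")
  case True
  then have "3 / 2 * real n ^ 2 - 19 / 2 * real n + 18 \<le> 3 / 2 * real n ^ 2"
    by simp
  then show ?thesis
    using ex_moves_reverse_to_identity[OF True] by metis
next
  case False
  with assms consider "n = 1" | "n = 2"
    by linarith
  then show ?thesis
  proof cases
    case 1
    then show ?thesis
      by (auto simp: reverse_perm_def identity_perm_def intro!: exI[of _ "[]"])
  next
    case 2
    then show ?thesis
      by (auto simp: reverse_perm_def identity_perm_def numeral_2_eq_2 intro!: exI[of _ "[E]"])
  qed
qed

end
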